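(* Let $W=\sum_{i=1}^n\gamma_ix^{v_i}$ be any positive generalised Puiseux polynomial (over $\mathbf K_{>0}$, on the torus $T$), and let $p$ be any point of $T(\mathbf K_{>0})$. Then the bilinear map $\mathcal H_p:N_{\mathbb R}\times N_{\mathbb R}\to\mathbf K$ defined by $\mathcal H_p(u_1,u_2):=\partial_{u_1}\partial_{u_2}W(p)$ has the property that $\mathcal H_p(u,u)\in\mathbf K_{>0}$ for all nonzero $u\in N_{\mathbb R}$.
   Context: $\mathbf K$ is the field of generalised Puiseux series $c(t)=\sum_kc_{\mu_k}t^{\mu_k}$, $c_{\mu_k}\in\mathbb C$, with real exponents forming a strictly increasing sequence that is finite or tends to $+\infty$; $\mathfrak m$ is the set of elements all of whose exponents are positive (including $0$); $\mathbf K_{>0}$ is the set of nonzero series with leading coefficient in $\mathbb R_{>0}$. $T$ is a split torus over $\mathbf K$ with character lattice $M\cong\mathbb Z^r$, cocharacter lattice $N$, dual pairing $\langle\ ,\ \rangle$, $M_{\mathbb R}=M\otimes\mathbb R$, $N_{\mathbb R}=N\otimes\mathbb R$, and $T(\mathbf K_{>0})=\operatorname{Hom}(M,\mathbf K_{>0})$. Every $p\in T(\mathbf K_{>0})$ is uniquely of the form $p=e^ut^d\exp_T(w)$ with $u,d\in N_{\mathbb R}$, $w\in N\otimes\mathfrak m$, meaning $p^v=e^{\langle v,u\rangle}t^{\langle v,d\rangle}\exp(\langle v,w\rangle)$ for $v\in M$ (with $\exp$ given by its power series on $\mathfrak m$); the same formula defines $p^v\in\mathbf K_{>0}$ for $v\in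 M_{\mathbb R}$. A (positive) generalised Puiseux polynomial over $\mathbf K_{>0}$ is an expression $W=\sum_{i=1}^n\gamma_ix^{v_i}$ with $\gamma_i\in\mathbf K_{>0}$ and $v_i\in M_{\mathbb R}$, regarded as the function $p\mapsto\sum_i\gamma_ip^{v_i}$ on $T(\mathbf K_{>0})$. For $u\in N_{\mathbb R}$, $\partial_u$ is the $\mathbf K$-linear operator with $\partial_u(x^v)=\langle v,u\rangle x^v$.
   Formalization: The formal theorem adds the hypothesis that the exponents v_i span M_R; without it the claim fails (e.g. W = γx^0 gives H_p(u,u) = 0), and spanning is necessary for the stated positivity. *)

theory Defs
  imports "HOL-Analysis.Analysis" "HOL-Library.Poly_Mapping"
begin

section \<open>The field of generalised Puiseux series\<close>

text \<open>
  A series is its coefficient function.  A set of reals is the set of members of a strictly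
  increasing sequence that is finite or tends to infinity iff it has only finitely many members
  below each bound; see lemma \<open>left_finite_iff_sequence\<close>.
\<close>

definition left_finite :: "real set \<Rightarrow> bool" where
  "left_finite S \<longleftrightarrow> (\<forall>B. finite {x \<in> S. x \<le> B})"

typedef puiseux = "{f :: real \<Rightarrow> complex. left_finite {x. f x \<noteq> 0}}"
  morphisms coeff Abs_puiseux
  by (rule exI[of _ "\<lambda>_. 0"]) (simp add: left_finite_def)

setup_lifting type_definition_puiseux

lemma left_finite_iff_sequence:
  "left_finite S \<longleftrightarrow>
     finite S \<or> (\<exists>\<mu> :: nat \<Rightarrow> real. strict_mono \<mu> \<and> filterlim \<mu> at_top sequentially \<and> S = range \<mu>)"
  (is "?L \<longleftrightarrow> ?R")
proof
  assume L: ?L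
  show ?R
  proof (cases "finite S")
    case False
    define next_above where "next_above x = Min {y \<in> S. x < y \<and> y \<le> (SOME z. z \<in> S \<and> x < z)}" for x
    have ex: "\<exists>z. z \<in> S \<and> x < z" for x
    proof (rule ccontr)
      assume "\<not> ?thesis"
      then have "S = {y \<in> S. y \<le> x}" by force
      then show False using L False by (metis left_finite_def)
    qed
    have nx: "next_above x \<in> S \<and> x < next_above x \<and> (\<forall>y\<in>S. x < y \<longrightarrow> next_above x \<le> y)" for x
    proof -
      define z where "z = (SOME z. z \<in> S \<and> x < z)"
      have z: "z \<in> S \<and> x < z" unfolding z_def using ex by (rule someI_ex)
      let ?A = "{y \<in> S. x < y \<and> y \<le> z}"
      have fin: "finite ?A"
        by (rule finite_subset[of _ "{y \<in> S. y \<le> z}"]) (use L in \<open>auto simp: left_finite_def\<close>)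
      have ne: "z \<in> ?A" using z by simp
      have eq: "next_above x = Min ?A" by (simp add: next_above_def z_def)
      have "Min ?A \<in> ?A" using fin ne by (intro Min_in) auto
      moreover have "Min ?A \<le> y" if "y \<in> S" "x < y" for y
      proof (cases "y \<le> z")
        case True then show ?thesis using fin that by (intro Min_le) auto
      next
        case False
        then show ?thesis using Min_le[OF fin ne] by linarith
      qed
      ultimately show ?thesis unfolding eq by blast
    qed
    obtain s where s: "s \<in> S" using False by fastforce
    define m where "m = Min {y \<in> S. y \<le> s}"
    have fin_s: "finite {y \<in> S. y \<le> s}" using L by (simp add: left_finite_def)
    have m: "m \<in> S" "\<And>y. y \<in> S \<Longrightarrow> m \<le> y"
    proof -
      show "m \<in> S" using Min_in[OF fin_s] s by (auto simp: m_def)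
      fix y assume "y \<in> S"
      moreover have "m \<le> s" using Min_le[OF fin_s, of s] s by (simp add: m_def)
      ultimately show "m \<le> y"
        using Min_le[OF fin_s, of y] by (cases "y \<le> s") (auto simp: m_def)
    qed
    define \<mu> where "\<mu> n = (next_above ^^ n) m" for n
    have \<mu>S: "\<mu> n \<in> S" for n by (cases n) (use m nx in \<open>auto simp: \<mu>_def\<close>)
    have sm: "strict_mono \<mu>" by (rule strict_monoI_Suc) (use nx in \<open>simp add: \<mu>_def\<close>)
    have unb: "\<exists>n. B < \<mu> n" for B
    proof (rule ccontr)
      assume "\<not> ?thesis"
      then have "range \<mu> \<subseteq> {x \<in> S. x \<le> B}" using \<mu>S by (auto simp: not_less)
      then have "finite (range \<mu>)" using L finite_subset by (auto simp: left_finite_def)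
      then show False
        using finite_imageD[of \<mu> UNIV] strict_mono_imp_inj_on[OF sm] by auto
    qed
    have lim: "filterlim \<mu> at_top sequentially"
      unfolding filterlim_at_top eventually_sequentially
    proof
      fix B
      obtain n where "B < \<mu> n" using unb by blast
      then show "\<exists>N. \<forall>n\<ge>N. B \<le> \<mu> n"
        using strict_mono_less_eq[OF sm] by (intro exI[of _ n]) (metis less_imp_le order_trans)
    qed
    have "S \<subseteq> range \<mu>"
    proof
      fix x assume x: "x \<in> S"
      define n where "n = (LEAST n. x < \<mu> n)"
      have n: "x < \<mu> n" unfolding n_def using unb by (rule LeastI_ex)
      show "x \<in> range \<mu>"
      proof (cases n)
        case 0
        then show ?thesis using n m(2)[OF x] by (simp add: \<mu>_def)
      next
        case (Suc k)
        then have "\<mu> k \<le> x" using not_less_Least[of k "\<lambda>n. x < \<mu> n"] by (simp add: n_def)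
        moreover have "\<not> \<mu> k < x" using nx[of "\<mu> k"] x n Suc by (auto simp: \<mu>_def)
        ultimately show ?thesis by auto
      qed
    qed
    then show ?R using sm lim \<mu>S by blast
  qed simp
next
  assume ?R
  then show ?L
  proof (elim disjE exE conjE)
    fix \<mu> :: "nat \<Rightarrow> real"
    assume \<mu>: "strict_mono \<mu>" "filterlim \<mu> at_top sequentially" "S = range \<mu>"
    show ?L unfolding left_finite_def
    proof
      fix B
      obtain N where N: "\<And>n. n \<ge> N \<Longrightarrow> B + 1 \<le> \<mu> n"
        using \<mu>(2) by (auto simp: filterlim_at_top eventually_sequentially)
      have "{x \<in> S. x \<le> B} \<subseteq> \<mu> ` {..<N}"
        using N \<mu>(3) by (force simp: not_le[symmetric])
      then show "finite {x \<in> S. x \<le> B}" by (rule finite_subset) simp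
    qed
  qed (simp add: left_finite_def)
qed

lemma puiseux_eqI: "(\<And>x. coeff f x = coeff g x) \<Longrightarrow> f = g"
  by (metis coeff_inject ext)

lemma finite_coeff: "finite {x. coeff f x \<noteq> 0 \<and> x \<le> B}"
  using coeff[of f] by (simp add: left_finite_def)

lemma coeff_Abs: "left_finite {x. f x \<noteq> 0} \<Longrightarrow> coeff (Abs_puiseux f) = f"
  by (simp add: Abs_puiseux_inverse)

lemma left_finite_subset: "left_finite T \<Longrightarrow> S \<subseteq> T \<Longrightarrow> left_finite S"
proof (unfold left_finite_def, rule allI)
  fix B
  assume "\<forall>B. finite {x \<in> T. x \<le> B}" "S \<subseteq> T"
  then show "finite {x \<in> S. x \<le> B}"
    by (intro finite_subset[of "{x \<in> S. x \<le> B}" "{x \<in> T. x \<le> B}"]) auto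
qed

lemma left_finite_Un: "left_finite S \<Longrightarrow> left_finite T \<Longrightarrow> left_finite (S \<union> T)"
  unfolding left_finite_def
proof
  fix B
  assume "\<forall>B. finite {x \<in> S. x \<le> B}" "\<forall>B. finite {x \<in> T. x \<le> B}"
  then have "finite ({x \<in> S. x \<le> B} \<union> {x \<in> T. x \<le> B})" by blast
  then show "finite {x \<in> S \<union> T. x \<le> B}" by (rule rev_finite_subset) auto
qed

lemma left_finite_lower_bound: "left_finite S \<Longrightarrow> \<exists>L. \<forall>x\<in>S. L \<le> x"
proof -
  assume "left_finite S"
  then have fin: "finite (insert 0 {x \<in> S. x \<le> 0})" by (simp add: left_finite_def)
  have "Min (insert 0 {x \<in> S. x \<le> 0}) \<le> x" if "x \<in> S" for x
  proof (cases "x \<le> 0")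
    case True then show ?thesis using fin that by (intro Min_le) auto
  next
    case False
    moreover have "Min (insert 0 {x \<in> S. x \<le> 0}) \<le> 0" using fin by (intro Min_le) auto
    ultimately show ?thesis by linarith
  qed
  then show ?thesis by blast
qed

lemma left_finite_sums:
  assumes "left_finite S" "left_finite T"
  shows "left_finite {x. \<exists>a. a \<in> S \<and> x - a \<in> T}"
  unfolding left_finite_def
proof
  fix B
  obtain L M where L: "\<forall>x\<in>S. L \<le> x" and M: "\<forall>x\<in>T. M \<le> x"
    using assms left_finite_lower_bound by meson
  have "finite ((\<lambda>(a, b). a + b) ` ({a \<in> S. a \<le> B - M} \<times> {b \<in> T. b \<le> B - L}))"
    using assms by (intro finite_imageI finite_cartesian_product) (auto simp: left_finite_def)
  moreover have "{x \<in> {x. \<exists>a. a \<in> S \<and> x - a \<in> T}. x \<le> B} \<subseteq>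
      (\<lambda>(a, b). a + b) ` ({a \<in> S. a \<le> B - M} \<times> {b \<in> T. b \<le> B - L})"
  proof (clarify, goal_cases)
    case (1 x a)
    then have "M \<le> x - a" "L \<le> a" using L M by auto
    then show ?case using 1 by (intro image_eqI[of _ _ "(a, x - a)"]) auto
  qed
  ultimately show "finite {x \<in> {x. \<exists>a. a \<in> S \<and> x - a \<in> T}. x \<le> B}"
    by (rule rev_finite_subset)
qed

lemma finite_convolution: "finite {a. coeff f a \<noteq> 0 \<and> coeff g (x - a) \<noteq> 0}"
proof -
  obtain M where M: "\<And>y. coeff g y \<noteq> 0 \<Longrightarrow> M \<le> y"
    using left_finite_lower_bound[of "{y. coeff g y \<noteq> 0}"] coeff[of g] by auto
  show ?thesis
    by (rule finite_subset[OF _ finite_coeff[of f "x - M"]]) (use M in force)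
qed

lemma sum_nonzeroD: "sum h {a. P a} \<noteq> 0 \<Longrightarrow> \<exists>a. P a"
  by (metis (mono_tags, lifting) mem_Collect_eq sum.neutral)

instantiation puiseux :: comm_ring_1
begin

lift_definition zero_puiseux :: puiseux is "\<lambda>_. 0"
  by (simp add: left_finite_def)

lift_definition one_puiseux :: puiseux is "\<lambda>x. if x = 0 then 1 else 0"
  by (simp add: left_finite_def)

lift_definition plus_puiseux :: "puiseux \<Rightarrow> puiseux \<Rightarrow> puiseux" is "\<lambda>f g x. f x + g x"
  by (erule left_finite_subset[OF left_finite_Un], assumption) auto

lift_definition uminus_puiseux :: "puiseux \<Rightarrow> puiseux" is "\<lambda>f x. - f x"
  by simp

lift_definition minus_puiseux :: "puiseux \<Rightarrow> puiseux \<Rightarrow> puiseux" is "\<lambda>f g x. f x - g x"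
  by (erule left_finite_subset[OF left_finite_Un], assumption) auto

lift_definition times_puiseux :: "puiseux \<Rightarrow> puiseux \<Rightarrow> puiseux"
  is "\<lambda>f g x. \<Sum>a | f a \<noteq> 0 \<and> g (x - a) \<noteq> 0. f a * g (x - a)"
proof -
  fix f g :: "real \<Rightarrow> complex"
  assume "left_finite {x. f x \<noteq> 0}" "left_finite {x. g x \<noteq> 0}"
  from left_finite_sums[OF this]
  show "left_finite {x. (\<Sum>a | f a \<noteq> 0 \<and> g (x - a) \<noteq> 0. f a * g (x - a)) \<noteq> 0}"
    by (rule left_finite_subset) (blast dest: sum_nonzeroD)
qed

lemma coeff_times:
  assumes "finite A" "\<And>a. coeff f a \<noteq> 0 \<Longrightarrow> coeff g (x - a) \<noteq> 0 \<Longrightarrow> a \<in> A"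
  shows "coeff (f * g) x = (\<Sum>a\<in>A. coeff f a * coeff g (x - a))"
  unfolding times_puiseux.rep_eq
  by (rule sum.mono_neutral_left) (use assms in auto)

instance
proof
  fix f g h :: puiseux
  show "f + g + h = f + (g + h)" by transfer (simp add: add.assoc)
  show "f + g = g + f" by transfer (simp add: add.commute)
  show "0 + f = f" by transfer simp
  show "- f + f = 0" by transfer simp
  show "f - g = f + - g" by transfer simp
  show "(0::puiseux) \<noteq> 1" by transfer (auto dest!: fun_cong[of _ _ 0])
  show comm: "f * g = g * f" for f g :: puiseux
  proof (rule puiseux_eqI)
    fix x
    show "coeff (f * g) x = coeff (g * f) x"
      unfolding times_puiseux.rep_eq
      by (rule sum.reindex_bij_witness[of _ "\<lambda>a. x - a" "\<lambda>a. x - a"]) (auto simp: mult.commute)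
  qed
  show "1 * f = f"
  proof (rule puiseux_eqI)
    fix x
    show "coeff (1 * f) x = coeff f x"
      by (subst coeff_times[of "{0}"]) (auto simp: one_puiseux.rep_eq split: if_splits)
  qed
  show "(f + g) * h = f * h + g * h"
  proof (rule puiseux_eqI)
    fix x
    let ?A = "{a. coeff f a \<noteq> 0 \<and> coeff h (x - a) \<noteq> 0} \<union> {a. coeff g a \<noteq> 0 \<and> coeff h (x - a) \<noteq> 0}"
    have fin: "finite ?A" by (simp add: finite_convolution)
    have "coeff ((f + g) * h) x = (\<Sum>a\<in>?A. coeff (f + g) a * coeff h (x - a))"
      by (rule coeff_times[OF fin]) (auto simp: plus_puiseux.rep_eq)
    also have "\<dots> = (\<Sum>a\<in>?A. coeff f a * coeff h (x - a)) + (\<Sum>a\<in>?A. coeff g a * coeff h (x - a))"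
      by (simp add: plus_puiseux.rep_eq distrib_right sum.distrib)
    also have "(\<Sum>a\<in>?A. coeff f a * coeff h (x - a)) = coeff (f * h) x"
      by (rule coeff_times[OF fin, symmetric]) auto
    also have "(\<Sum>a\<in>?A. coeff g a * coeff h (x - a)) = coeff (g * h) x"
      by (rule coeff_times[OF fin, symmetric]) auto
    finally show "coeff ((f + g) * h) x = coeff (f * h + g * h) x"
      by (simp add: plus_puiseux.rep_eq)
  qed
  show "f * g * h = f * (g * h)"
  proof (rule puiseux_eqI)
    fix x
    obtain F where F: "\<And>y. coeff f y \<noteq> 0 \<Longrightarrow> F \<le> y"
      using left_finite_lower_bound[of "{y. coeff f y \<noteq> 0}"] coeff[of f] by auto
    obtain G where G: "\<And>y. coeff g y \<noteq> 0 \<Longrightarrow> G \<le> y"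
      using left_finite_lower_bound[of "{y. coeff g y \<noteq> 0}"] coeff[of g] by auto
    obtain H where H: "\<And>y. coeff h y \<noteq> 0 \<Longrightarrow> H \<le> y"
      using left_finite_lower_bound[of "{y. coeff h y \<noteq> 0}"] coeff[of h] by auto
    have prod_bound: "P + Q \<le> y" if nz: "coeff (p * q) y \<noteq> 0" "\<And>y. coeff p y \<noteq> 0 \<Longrightarrow> P \<le> y"
      "\<And>y. coeff q y \<noteq> 0 \<Longrightarrow> Q \<le> y" for p q y P Q
    proof -
      obtain a where "coeff p a \<noteq> 0" "coeff q (y - a) \<noteq> 0"
        using sum_nonzeroD[OF nz(1)[unfolded times_puiseux.rep_eq]] by blast
      then show ?thesis using that(2,3) by fastforce
    qed
    define A where "A = {a. coeff f a \<noteq> 0 \<and> a \<le> x - (G + H)}"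
    define C where "C = {c. coeff h c \<noteq> 0 \<and> c \<le> x - (F + G)}"
    have fin: "finite A" "finite C" by (simp_all add: A_def C_def finite_coeff)
    have "coeff (f * g * h) x = coeff (h * (f * g)) x" by (simp only: comm[of "f * g" h])
    also have "\<dots> = (\<Sum>c\<in>C. coeff h c * coeff (f * g) (x - c))"
      by (rule coeff_times[OF fin(2)]) (auto simp: C_def dest!: prod_bound[OF _ F G])
    also have "\<dots> = (\<Sum>c\<in>C. coeff h c * (\<Sum>a\<in>A. coeff f a * coeff g (x - c - a)))"
    proof (intro sum.cong refl arg_cong2[of _ _ _ _ "(*)"] coeff_times fin)
      fix c a
      assume "c \<in> C" "coeff f a \<noteq> 0" "coeff g (x - c - a) \<noteq> 0"
      then show "a \<in> A" using G[of "x - c - a"] H[of c] by (auto simp: A_def C_def)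
    qed
    also have "\<dots> = (\<Sum>c\<in>C. \<Sum>a\<in>A. coeff f a * (coeff h c * coeff g (x - a - c)))"
      by (simp add: sum_distrib_left algebra_simps)
    also have "\<dots> = (\<Sum>a\<in>A. \<Sum>c\<in>C. coeff f a * (coeff h c * coeff g (x - a - c)))"
      by (rule sum.swap)
    also have "\<dots> = (\<Sum>a\<in>A. coeff f a * (\<Sum>c\<in>C. coeff h c * coeff g (x - a - c)))"
      by (simp add: sum_distrib_left)
    also have "\<dots> = (\<Sum>a\<in>A. coeff f a * coeff (h * g) (x - a))"
    proof (intro sum.cong refl arg_cong2[of _ _ _ _ "(*)"] coeff_times[symmetric] fin)
      fix a c
      assume "a \<in> A" "coeff h c \<noteq> 0" "coeff g (x - a - c) \<noteq> 0"
      then show "c \<in> C" using G[of "x - a - c"] F[of a] by (auto simp: A_def C_def)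
    qed
    also have "\<dots> = coeff (f * (h * g)) x"
      by (rule coeff_times[OF fin(1), symmetric]) (auto simp: A_def dest!: prod_bound[OF _ H G])
    also have "h * g = g * h" by (rule comm)
    finally show "coeff (f * g * h) x = coeff (f * (g * h)) x" .
  qed
qed

end

lemma coeff_zero [simp]: "coeff 0 x = 0"
  and coeff_one: "coeff 1 x = (if x = 0 then 1 else 0)"
  and coeff_add [simp]: "coeff (f + g) x = coeff f x + coeff g x"
  and coeff_uminus [simp]: "coeff (- f) x = - coeff f x"
  and coeff_diff [simp]: "coeff (f - g) x = coeff f x - coeff g x"
  by (simp_all add: zero_puiseux.rep_eq one_puiseux.rep_eq plus_puiseux.rep_eq
      uminus_puiseux.rep_eq minus_puiseux.rep_eq)

text \<open>The term \<open>c t^d\<close>.\<close>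

lift_definition puiseux_term :: "complex \<Rightarrow> real \<Rightarrow> puiseux" is "\<lambda>c d x. if x = d then c else 0"
  by (simp add: left_finite_def)

lemma coeff_term_times: "coeff (puiseux_term c d * f) x = c * coeff f (x - d)"
  by (subst coeff_times[of "{d}"]) (auto simp: puiseux_term.rep_eq split: if_splits)

text \<open>Meaningful for nonzero series only.\<close>

definition leading_exponent :: "puiseux \<Rightarrow> real" where
  "leading_exponent f = (LEAST x. coeff f x \<noteq> 0)"

definition leading_coeff :: "puiseux \<Rightarrow> complex" where
  "leading_coeff f = coeff f (leading_exponent f)"

lemma leading_exponent:
  assumes "f \<noteq> 0"
  shows "coeff f (leading_exponent f) \<noteq> 0" "\<And>x. coeff f x \<noteq> 0 \<Longrightarrow> leading_exponent f \<le> x"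
proof -
  obtain s where s: "coeff f s \<noteq> 0" using assms puiseux_eqI[of f 0] by auto
  define m where "m = Min {x. coeff f x \<noteq> 0 \<and> x \<le> s}"
  have m: "coeff f m \<noteq> 0" using Min_in[OF finite_coeff[of f s]] s by (auto simp: m_def)
  have le: "m \<le> x" if "coeff f x \<noteq> 0" for x
    using Min_le[OF finite_coeff[of f s], of x] Min_le[OF finite_coeff[of f s], of s] s that
    by (cases "x \<le> s") (auto simp: m_def)
  have "leading_exponent f = m" unfolding leading_exponent_def
    by (rule Least_equality) (use m le in auto)
  then show "coeff f (leading_exponent f) \<noteq> 0" "\<And>x. coeff f x \<noteq> 0 \<Longrightarrow> leading_exponent f \<le> x"
    using m le by auto
qed

definition puiseux_pos :: "puiseux set" where
  "puiseux_pos = {f. f \<noteq> 0 \<and> leading_coeff f \<in> complex_of_real ` {0<..}}"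

definition puiseux_m :: "puiseux set" where
  "puiseux_m = {f. \<forall>x. coeff f x \<noteq> 0 \<longrightarrow> 0 < x}"

lemma puiseux_m_powers:
  assumes "f \<in> puiseux_m"
  shows "\<exists>\<epsilon>>0. \<forall>k x. coeff (f ^ k) x \<noteq> 0 \<longrightarrow> real k * \<epsilon> \<le> x"
proof -
  define \<epsilon> where "\<epsilon> = Min (insert 1 {x. coeff f x \<noteq> 0 \<and> x \<le> 1})"
  have fin: "finite (insert 1 {x. coeff f x \<noteq> 0 \<and> x \<le> 1})" by (simp add: finite_coeff)
  have pos: "\<epsilon> > 0" using assms fin by (auto simp: \<epsilon>_def puiseux_m_def)
  have \<epsilon>1: "\<epsilon> \<le> 1" using fin by (simp add: \<epsilon>_def)
  have le: "\<epsilon> \<le> x" if "coeff f x \<noteq> 0" for x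
    using \<epsilon>1 Min_le[OF fin, of x] that by (cases "x \<le> 1") (auto simp: \<epsilon>_def)
  have "coeff (f ^ k) x \<noteq> 0 \<longrightarrow> real k * \<epsilon> \<le> x" for k x
  proof (induction k arbitrary: x)
    case 0
    then show ?case by (simp add: coeff_one)
  next
    case (Suc k)
    show ?case
    proof
      assume "coeff (f ^ Suc k) x \<noteq> 0"
      then obtain a where "coeff f a \<noteq> 0" "coeff (f ^ k) (x - a) \<noteq> 0"
        unfolding power_Suc times_puiseux.rep_eq by (blast dest: sum_nonzeroD)
      then show "real (Suc k) * \<epsilon> \<le> x" using le[of a] Suc[of "x - a"] by (simp add: algebra_simps)
    qed
  qed
  then show ?thesis using pos by blast
qed

lemma puiseux_m_powers_bound:
  assumes "f \<in> puiseux_m"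
  shows "\<exists>K. \<forall>k\<ge>K. \<forall>x\<le>B. coeff (f ^ k) x = 0"
proof -
  obtain \<epsilon> where \<epsilon>: "\<epsilon> > 0" "\<And>k x. coeff (f ^ k) x \<noteq> 0 \<Longrightarrow> real k * \<epsilon> \<le> x"
    using puiseux_m_powers[OF assms] by blast
  obtain K :: nat where K: "B < real K * \<epsilon>" using reals_Archimedean3[OF \<epsilon>(1)] by blast
  have "coeff (f ^ k) x = 0" if "K \<le> k" "x \<le> B" for k x
  proof (rule ccontr)
    assume "coeff (f ^ k) x \<noteq> 0"
    then have "real k * \<epsilon> \<le> B" using \<epsilon>(2) that(2) by fastforce
    moreover have "real K * \<epsilon> \<le> real k * \<epsilon>" using that(1) \<epsilon>(1) by simp
    ultimately show False using K by linarith
  qed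
  then show ?thesis by blast
qed

text \<open>
  The value at \<open>f\<close> of the formal power series with coefficients \<open>a\<close>, for \<open>f \<in> puiseux_m\<close>.  By
  \<open>puiseux_m_powers_bound\<close>, each coefficient of the result is a sum with finitely many nonzero
  terms.
\<close>

definition power_series :: "(nat \<Rightarrow> complex) \<Rightarrow> puiseux \<Rightarrow> puiseux" where
  "power_series a f = Abs_puiseux (\<lambda>x. suminf (\<lambda>k. a k * coeff (f ^ k) x))"

definition puiseux_exp :: "puiseux \<Rightarrow> puiseux" where
  "puiseux_exp = power_series (\<lambda>k. 1 / fact k)"

lemma coeff_power_series:
  assumes "f \<in> puiseux_m"
  shows "coeff (power_series a f) x = suminf (\<lambda>k. a k * coeff (f ^ k) x)"
proof -
  have "left_finite {x. suminf (\<lambda>k. a k * coeff (f ^ k) x) \<noteq> 0}"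
    unfolding left_finite_def
  proof
    fix B
    obtain K where K: "\<And>k x. k \<ge> K \<Longrightarrow> x \<le> B \<Longrightarrow> coeff (f ^ k) x = 0"
      using puiseux_m_powers_bound[OF assms, of B] by blast
    have "{x \<in> {x. suminf (\<lambda>k. a k * coeff (f ^ k) x) \<noteq> 0}. x \<le> B} \<subseteq>
        (\<Union>k<K. {x. coeff (f ^ k) x \<noteq> 0 \<and> x \<le> B})"
    proof clarify
      fix x
      assume x: "suminf (\<lambda>k. a k * coeff (f ^ k) x) \<noteq> 0" "x \<le> B"
      have "\<exists>k. coeff (f ^ k) x \<noteq> 0"
      proof (rule ccontr)
        assume "\<not> ?thesis"
        then have "(\<lambda>k. a k * coeff (f ^ k) x) = (\<lambda>_. 0)" by (intro ext) simp
        then show False using x(1) by simp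
      qed
      then obtain k where k: "coeff (f ^ k) x \<noteq> 0" ..
      have "k < K" using K[of k x] x(2) k by (meson not_less)
      with k x(2) show "x \<in> (\<Union>k<K. {x. coeff (f ^ k) x \<noteq> 0 \<and> x \<le> B})" by blast
    qed
    then show "finite {x \<in> {x. suminf (\<lambda>k. a k * coeff (f ^ k) x) \<noteq> 0}. x \<le> B}"
      by (rule finite_subset) (simp add: finite_coeff)
  qed
  then show ?thesis by (simp add: power_series_def coeff_Abs)
qed

lemma coeff_sum: "coeff (sum g A) x = (\<Sum>a\<in>A. coeff (g a) x)"
  by (induction A rule: infinite_finite_induct) auto

lemma geometric_series:
  assumes "f \<in> puiseux_m"
  shows "(1 - f) * power_series (\<lambda>_. 1) f = 1"
proof (rule puiseux_eqI)
  fix x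
  let ?g = "power_series (\<lambda>_. 1) f"
  obtain K where K: "\<And>k y. k \<ge> K \<Longrightarrow> y \<le> x \<Longrightarrow> coeff (f ^ k) y = 0"
    using puiseux_m_powers_bound[OF assms, of x] by blast
  have f0: "coeff (1 - f) a \<noteq> 0 \<Longrightarrow> 0 \<le> a" for a
    using assms by (force simp: puiseux_m_def coeff_one split: if_splits)
  have g: "coeff ?g y = coeff (\<Sum>k<K. f ^ k) y" if "y \<le> x" for y
  proof -
    have "coeff ?g y = (\<Sum>k<K. 1 * coeff (f ^ k) y)"
      unfolding coeff_power_series[OF assms] by (rule suminf_finite) (use K that in auto)
    then show ?thesis by (simp add: coeff_sum)
  qed
  have "coeff ((1 - f) * ?g) x = coeff ((1 - f) * (\<Sum>k<K. f ^ k)) x"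
  proof -
    have eq: "coeff ?g (x - a) = coeff (\<Sum>k<K. f ^ k) (x - a)" if "coeff (1 - f) a \<noteq> 0" for a
      using f0[OF that] g[of "x - a"] by simp
    have "{a. coeff (1 - f) a \<noteq> 0 \<and> coeff ?g (x - a) \<noteq> 0} =
        {a. coeff (1 - f) a \<noteq> 0 \<and> coeff (\<Sum>k<K. f ^ k) (x - a) \<noteq> 0}"
      by (intro Collect_cong conj_cong refl) (drule eq, simp only:)
    then show ?thesis
      unfolding times_puiseux.rep_eq
      by (intro sum.cong) (simp_all del: coeff_diff add: eq)
  qed
  also have "\<dots> = coeff (1 - f ^ K) x" by (simp only: one_diff_power_eq)
  also have "\<dots> = coeff 1 x" using K[of K x] by simp
  finally show "coeff ((1 - f) * ?g) x = coeff 1 x" .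
qed

lemma puiseux_inverse_ex:
  assumes "f \<noteq> 0"
  shows "\<exists>g :: puiseux. g * f = 1"
proof -
  let ?d = "leading_exponent f" and ?c = "leading_coeff f"
  have c: "?c \<noteq> 0" using leading_exponent(1)[OF assms] by (simp add: leading_coeff_def)
  define h where "h = 1 - puiseux_term (1 / ?c) (- ?d) * f"
  have h: "coeff h x = (if x = 0 then 1 else 0) - coeff f (x + ?d) / ?c" for x
    by (simp add: h_def coeff_one coeff_term_times)
  have "h \<in> puiseux_m" unfolding puiseux_m_def
  proof clarify
    fix x
    assume x: "coeff h x \<noteq> 0"
    have "x \<noteq> 0"
      using x c by (auto simp: h leading_coeff_def)
    then have "coeff f (x + ?d) \<noteq> 0" using x by (simp add: h)
    then show "0 < x" using leading_exponent(2)[OF assms, of "x + ?d"] \<open>x \<noteq> 0\<close> by simp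
  qed
  from geometric_series[OF this]
  have "power_series (\<lambda>_. 1) h * puiseux_term (1 / ?c) (- ?d) * f = 1"
    by (simp add: h_def ac_simps)
  then show ?thesis by blast
qed

instantiation puiseux :: inverse
begin

definition inverse_puiseux :: "puiseux \<Rightarrow> puiseux" where
  "inverse_puiseux f = (if f = 0 then 0 else SOME g. g * f = 1)"

definition divide_puiseux :: "puiseux \<Rightarrow> puiseux \<Rightarrow> puiseux" where
  "divide_puiseux f g = f * inverse g"

instance ..

end

instance puiseux :: field
proof
  fix f g :: puiseux
  show "f \<noteq> 0 \<Longrightarrow> inverse f * f = 1"
    using someI_ex[OF puiseux_inverse_ex] by (simp add: inverse_puiseux_def)
  show "f / g = f * inverse g" by (simp add: divide_puiseux_def)
  show "inverse (0::puiseux) = 0" by (simp add: inverse_puiseux_def)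
qed

instantiation puiseux :: real_field
begin

lift_definition scaleR_puiseux :: "real \<Rightarrow> puiseux \<Rightarrow> puiseux" is "\<lambda>r f x. r *\<^sub>R f x"
  by (erule left_finite_subset) auto

instance
proof
  fix r s :: real and f g :: puiseux
  show "r *\<^sub>R (f + g) = r *\<^sub>R f + r *\<^sub>R g" by transfer (simp add: scaleR_add_right)
  show "(r + s) *\<^sub>R f = r *\<^sub>R f + s *\<^sub>R f" by transfer (simp add: scaleR_add_left)
  show "r *\<^sub>R s *\<^sub>R f = (r * s) *\<^sub>R f" by transfer simp
  show "1 *\<^sub>R f = f" by transfer simp
  have eq: "r *\<^sub>R f = puiseux_term (of_real r) 0 * f" for r f
    by (rule puiseux_eqI) (simp add: scaleR_puiseux.rep_eq coeff_term_times scaleR_conv_of_real)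
  show "r *\<^sub>R f * g = r *\<^sub>R (f * g)" "f * r *\<^sub>R g = r *\<^sub>R (f * g)"
    unfolding eq by (simp_all add: ac_simps)
qed

end

section \<open>The torus and its positive points\<close>

text \<open>
  A basis identifies the character lattice \<open>M\<close> and the cocharacter lattice \<open>N\<close> with
  \<open>int ^ 'r\<close>, in such a way that the dual pairing is the standard one.  Then \<open>M\<^sub>\<real>\<close> and \<open>N\<^sub>\<real>\<close>
  are \<open>real ^ 'r\<close> with pairing \<open>v \<bullet> u\<close>, and \<open>N \<otimes> \<mm>\<close> consists of the
  \<open>w :: puiseux ^ 'r\<close> with entries in \<open>puiseux_m\<close>.
\<close>

definition torus_pos :: "(int ^ 'r \<Rightarrow> puiseux) set" where
  "torus_pos = {p. (\<forall>v. p v \<in> puiseux_pos) \<and> (\<forall>v w. p (v + w) = p v * p w)}"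

definition real_char :: "int ^ 'r \<Rightarrow> real ^ 'r" where
  "real_char v = (\<chi> j. real_of_int (v $ j))"

definition pairing_m :: "real ^ 'r \<Rightarrow> puiseux ^ 'r \<Rightarrow> puiseux" where
  "pairing_m v w = (\<Sum>j\<in>UNIV. (v $ j) *\<^sub>R (w $ j))"

text \<open>The value at \<open>v\<close> of the point \<open>e^u t^d exp\<^sub>T(w)\<close>.\<close>

definition polar_value :: "real ^ 'r \<Rightarrow> real ^ 'r \<Rightarrow> puiseux ^ 'r \<Rightarrow> real ^ 'r \<Rightarrow> puiseux" where
  "polar_value u d w v =
     of_real (exp (v \<bullet> u)) * puiseux_term 1 (v \<bullet> d) * puiseux_exp (pairing_m v w)"

definition is_polar_form ::
  "(int ^ 'r \<Rightarrow> puiseux) \<Rightarrow> (real ^ 'r) \<times> (real ^ 'r) \<times> (puiseux ^ 'r) \<Rightarrow> bool" where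
  "is_polar_form p = (\<lambda>(u, d, w).
     (\<forall>j. w $ j \<in> puiseux_m) \<and> (\<forall>v. p v = polar_value u d w (real_char v)))"

text \<open>\<open>p^v\<close> for a real character \<open>v\<close>, by way of the unique polar form of \<open>p \<in> torus_pos\<close>.\<close>

definition real_power :: "(int ^ 'r \<Rightarrow> puiseux) \<Rightarrow> real ^ 'r \<Rightarrow> puiseux" where
  "real_power p v = (case (THE c. is_polar_form p c) of (u, d, w) \<Rightarrow> polar_value u d w v)"

section \<open>Generalised Puiseux polynomials\<close>

text \<open>
  Expressions \<open>\<Sum>\<^sub>i c\<^sub>i x^v\<^sub>i\<close> with coefficients in the field and exponents in \<open>M\<^sub>\<real>\<close> are the
  elements of the group algebra of \<open>M\<^sub>\<real>\<close>; \<open>Poly_Mapping.single v c\<close> is \<open>c x^v\<close>.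
\<close>

type_synonym 'r puiseux_poly = "real ^ 'r \<Rightarrow>\<^sub>0 puiseux"

definition poly_of_terms :: "nat \<Rightarrow> (nat \<Rightarrow> puiseux) \<Rightarrow> (nat \<Rightarrow> real ^ 'r) \<Rightarrow> 'r puiseux_poly" where
  "poly_of_terms n \<gamma> v = (\<Sum>i<n. Poly_Mapping.single (v i) (\<gamma> i))"

definition poly_eval :: "'r puiseux_poly \<Rightarrow> (int ^ 'r \<Rightarrow> puiseux) \<Rightarrow> puiseux" where
  "poly_eval W p = (\<Sum>v\<in>Poly_Mapping.keys W. Poly_Mapping.lookup W v * real_power p v)"

definition log_deriv :: "real ^ 'r \<Rightarrow> 'r puiseux_poly \<Rightarrow> 'r puiseux_poly" where
  "log_deriv u W = Poly_Mapping.mapp (\<lambda>v c. of_real (v \<bullet> u) * c) W"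

lemma lookup_log_deriv:
  "Poly_Mapping.lookup (log_deriv u W) v = of_real (v \<bullet> u) * Poly_Mapping.lookup W v"
  by (simp add: log_deriv_def lookup_mapp in_keys_iff when_def)

lemma log_deriv_single:
  "log_deriv u (Poly_Mapping.single v c) = Poly_Mapping.single v (of_real (v \<bullet> u) * c)"
  by (rule poly_mapping_eqI) (simp add: lookup_log_deriv lookup_single when_def)

lemma log_deriv_add: "log_deriv u (W + W') = log_deriv u W + log_deriv u W'"
  by (rule poly_mapping_eqI) (simp add: lookup_log_deriv lookup_add distrib_left)

lemma log_deriv_smult:
  "log_deriv u (Poly_Mapping.map ((*) c) W) = Poly_Mapping.map ((*) c) (log_deriv u W)"
  by (rule poly_mapping_eqI) (simp add: lookup_log_deriv Poly_Mapping.map.rep_eq when_def)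

lemma poly_eval_superset:
  assumes "finite S" "Poly_Mapping.keys W \<subseteq> S"
  shows "poly_eval W p = (\<Sum>v\<in>S. Poly_Mapping.lookup W v * real_power p v)"
  unfolding poly_eval_def by (rule sum.mono_neutral_left) (use assms in \<open>auto simp: in_keys_iff\<close>)

lemma poly_eval_poly_of_terms:
  "poly_eval (poly_of_terms n \<gamma> v) p = (\<Sum>i<n. \<gamma> i * real_power p (v i))"
proof -
  have lk: "Poly_Mapping.lookup (poly_of_terms n \<gamma> v) x = (\<Sum>i<n. if v i = x then \<gamma> i else 0)" for x
    by (simp add: poly_of_terms_def lookup_sum lookup_single when_def)
  have "Poly_Mapping.keys (poly_of_terms n \<gamma> v) \<subseteq> v ` {..<n}"
  proof
    fix x assume "x \<in> Poly_Mapping.keys (poly_of_terms n \<gamma> v)"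
    then have "(\<Sum>i<n. if v i = x then \<gamma> i else 0) \<noteq> 0" by (simp add: in_keys_iff lk)
    then obtain i where "i < n" "v i = x"
      by (rule sum.not_neutral_contains_not_neutral) (auto split: if_splits)
    then show "x \<in> v ` {..<n}" by blast
  qed
  then have "poly_eval (poly_of_terms n \<gamma> v) p =
      (\<Sum>x\<in>v ` {..<n}. Poly_Mapping.lookup (poly_of_terms n \<gamma> v) x * real_power p x)"
    by (intro poly_eval_superset) auto
  also have "\<dots> = (\<Sum>x\<in>v ` {..<n}. \<Sum>i<n. if v i = x then \<gamma> i * real_power p x else 0)"
    by (simp add: lk sum_distrib_right if_distrib[of "\<lambda>z. z * _"] cong: if_cong)
  also have "\<dots> = (\<Sum>i<n. \<Sum>x\<in>v ` {..<n}. if v i = x then \<gamma> i * real_power p x else 0)"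
    by (rule sum.swap)
  also have "\<dots> = (\<Sum>i<n. \<gamma> i * real_power p (v i))"
    by (intro sum.cong refl) simp
  finally show ?thesis .
qed

definition hessian ::
  "'r puiseux_poly \<Rightarrow> (int ^ 'r \<Rightarrow> puiseux) \<Rightarrow> real ^ 'r \<Rightarrow> real ^ 'r \<Rightarrow> puiseux" where
  "hessian W p u1 u2 = poly_eval (log_deriv u1 (log_deriv u2 W)) p"

text \<open>
  Positivity of \<open>hessian W p u u\<close> for all nonzero \<open>u\<close> forces the exponents of \<open>W\<close> to span
  \<open>M\<^sub>\<real>\<close>: if they do not, then some nonzero \<open>u\<close> is orthogonal to all of them.
\<close>

lemma hessian_eq_0:
  assumes "\<And>i. i < n \<Longrightarrow> v i \<bullet> u = 0"
  shows "hessian (poly_of_terms n \<gamma> v) p u u = 0"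
proof -
  have "log_deriv u (poly_of_terms n \<gamma> v) = 0"
  proof (rule poly_mapping_eqI)
    fix x
    have "Poly_Mapping.lookup (log_deriv u (poly_of_terms n \<gamma> v)) x =
        (\<Sum>i<n. of_real (x \<bullet> u) * (if v i = x then \<gamma> i else 0))"
      by (simp add: lookup_log_deriv poly_of_terms_def lookup_sum lookup_single when_def
          sum_distrib_left)
    also have "\<dots> = 0" by (rule sum.neutral) (use assms in auto)
    finally show "Poly_Mapping.lookup (log_deriv u (poly_of_terms n \<gamma> v)) x =
        Poly_Mapping.lookup 0 x" by simp
  qed
  then show ?thesis by (simp add: hessian_def poly_eval_def log_deriv_def mapp_def keys_def)
qed

lemma hessian_pos_imp_span:
  fixes v :: "nat \<Rightarrow> real ^ 'r"
  assumes "\<And>u. u \<noteq> 0 \<Longrightarrow> hessian (poly_of_terms n \<gamma> v) p u u \<in> puiseux_pos"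
  shows "span (v ` {..<n}) = UNIV"
proof (rule ccontr)
  assume "span (v ` {..<n}) \<noteq> UNIV"
  then obtain u where "u \<noteq> 0" "\<forall>x \<in> span (v ` {..<n}). u \<bullet> x = 0"
    using span_not_univ_subset_hyperplane[of "v ` {..<n}"] by blast
  then have "\<And>i. i < n \<Longrightarrow> v i \<bullet> u = 0" by (auto simp: inner_commute span_base)
  then have "hessian (poly_of_terms n \<gamma> v) p u u = 0" by (rule hessian_eq_0)
  then show False using assms[OF \<open>u \<noteq> 0\<close>] by (simp add: puiseux_pos_def)
qed

end

theory Submission
  imports Defs
begin

text \<open>
  The Hessian is the sum of the terms
  \<open>\<langle>v\<^sub>i, u\<^sub>1\<rangle> \<langle>v\<^sub>i, u\<^sub>2\<rangle> \<gamma>\<^sub>i p^v\<^sub>i\<close>.  On the diagonal these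
  are non-negative real multiples of positive series, and one of the multiples is nonzero because the
  \<open>v\<^sub>i\<close> span.  Leading coefficients of positive series cannot cancel, so the sum is positive.

  The substance is that \<open>p^v\<close> is positive, that is, that the polar form of \<open>p\<close> exists and
  is unique.  This reduces to \<open>exp\<close> being an isomorphism from the additive group \<open>\<mm>\<close> to the
  group \<open>1 + \<mm>\<close>.  All of this follows from the derivation \<open>D = t d/dt\<close>: it restricts to a
  bijection of \<open>\<mm>\<close>, it satisfies \<open>D (exp f) = exp f \<cdot> D f\<close>, and two elements of
  \<open>1 + \<mm>\<close> with the same logarithmic derivative coincide.
\<close>

section \<open>The exponent filtration\<close>

text \<open>The series of valuation at least \<open>e\<close>, with 0 included. This filtration
  stands in for a topology: limits are handled modulo each of its members.\<close>

definition exponents_ge :: "real \<Rightarrow> puiseux set" where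
  "exponents_ge e = {f. \<forall>x. coeff f x \<noteq> 0 \<longrightarrow> e \<le> x}"

lemma exponents_ge_iff: "f \<in> exponents_ge e \<longleftrightarrow> (\<forall>x<e. coeff f x = 0)"
  unfolding exponents_ge_def mem_Collect_eq by (meson not_less)

lemma exponents_geD: "f \<in> exponents_ge e \<Longrightarrow> x < e \<Longrightarrow> coeff f x = 0"
  by (simp add: exponents_ge_iff)

lemma exponents_ge_mono: "f \<in> exponents_ge e \<Longrightarrow> d \<le> e \<Longrightarrow> f \<in> exponents_ge d"
  by (simp add: exponents_ge_iff)

lemma coeff_times_nonzeroE:
  assumes "coeff (f * g) x \<noteq> 0"
  obtains a where "coeff f a \<noteq> 0" "coeff g (x - a) \<noteq> 0"
  using sum_nonzeroD[OF assms[unfolded times_puiseux.rep_eq]] by blast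

lemma exponents_ge_diff:
  "f \<in> exponents_ge e \<Longrightarrow> g \<in> exponents_ge e \<Longrightarrow> f - g \<in> exponents_ge e"
  by (simp add: exponents_ge_iff)

lemma exponents_ge_times:
  assumes "f \<in> exponents_ge d" "g \<in> exponents_ge e"
  shows "f * g \<in> exponents_ge (d + e)"
  unfolding exponents_ge_def
proof clarify
  fix x
  assume "coeff (f * g) x \<noteq> 0"
  then obtain a where "coeff f a \<noteq> 0" "coeff g (x - a) \<noteq> 0"
    by (rule coeff_times_nonzeroE)
  then have "d \<le> a" "e \<le> x - a" using assms by (auto simp: exponents_ge_def)
  then show "d + e \<le> x" by simp
qed

text \<open>The filtration is separated: each exponent lies below some multiple of \<open>e\<close>,
  where the difference has no coefficient.\<close>

lemma exponents_ge_eqI: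
  assumes "\<And>k::nat. f - g \<in> exponents_ge (real k * e)" "0 < e"
  shows "f = g"
proof (rule puiseux_eqI)
  fix x
  obtain k :: nat where "x < real k * e" using reals_Archimedean3[OF assms(2)] by blast
  then have "coeff (f - g) x = 0" using assms(1) exponents_geD by blast
  then show "coeff f x = coeff g x" by simp
qed

section \<open>The ideal \<mm>\<close>

lemma puiseux_m_iff: "f \<in> puiseux_m \<longleftrightarrow> (\<forall>x\<le>0. coeff f x = 0)"
  unfolding puiseux_m_def mem_Collect_eq by (meson not_less)

text \<open>Exponents cannot accumulate at 0, so positive ones have a positive lower bound; it is
  read off from the bound on powers at \<open>k = 1\<close>.\<close>

lemma puiseux_m_iff_exponents_ge: "f \<in> puiseux_m \<longleftrightarrow> (\<exists>e>0. f \<in> exponents_ge e)"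
proof
  assume "f \<in> puiseux_m"
  from puiseux_m_powers[OF this]
  obtain e where "e > 0" "\<forall>k x. coeff (f ^ k) x \<noteq> 0 \<longrightarrow> real k * e \<le> x" by blast
  then have "e \<le> x" if "coeff f x \<noteq> 0" for x
    using that by (metis mult_1 of_nat_1 power_one_right)
  then have "f \<in> exponents_ge e" by (simp add: exponents_ge_def)
  then show "\<exists>e>0. f \<in> exponents_ge e" using \<open>e > 0\<close> by blast
qed (auto simp: exponents_ge_iff puiseux_m_iff)

lemma puiseux_m_add: "f \<in> puiseux_m \<Longrightarrow> g \<in> puiseux_m \<Longrightarrow> f + g \<in> puiseux_m"
  by (simp add: puiseux_m_iff)

lemma puiseux_m_uminus: "f \<in> puiseux_m \<Longrightarrow> - f \<in> puiseux_m"
  by (simp add: puiseux_m_iff)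

lemma puiseux_m_zero: "0 \<in> puiseux_m"
  by (simp add: puiseux_m_iff)

lemma puiseux_m_scaleR: "f \<in> puiseux_m \<Longrightarrow> r *\<^sub>R f \<in> puiseux_m"
  by (simp add: puiseux_m_iff scaleR_puiseux.rep_eq)

lemma puiseux_m_times: "f \<in> puiseux_m \<Longrightarrow> g \<in> puiseux_m \<Longrightarrow> f * g \<in> puiseux_m"
  unfolding puiseux_m_iff_exponents_ge by (blast intro: add_pos_pos exponents_ge_times)

lemma puiseux_m_sum: "(\<And>a. a \<in> A \<Longrightarrow> f a \<in> puiseux_m) \<Longrightarrow> sum f A \<in> puiseux_m"
  by (induction A rule: infinite_finite_induct) (auto simp: puiseux_m_zero intro: puiseux_m_add)

lemma exponents_ge_power:
  assumes "f \<in> exponents_ge e"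
  shows "f ^ k \<in> exponents_ge (real k * e)"
proof (induction k)
  case 0
  then show ?case by (simp add: exponents_ge_def coeff_one)
next
  case (Suc k)
  then show ?case using exponents_ge_times[OF assms Suc] by (simp add: algebra_simps)
qed

text \<open>Powers \<open>f ^ k\<close> with \<open>k \<ge> K\<close> have no exponent below
  \<open>K * e\<close>, so only the first \<open>K\<close> terms are visible there. The factor
  \<open>puiseux_term (a k) 0\<close> is the constant \<open>a k\<close>.\<close>

lemma power_series_tail:
  assumes "f \<in> exponents_ge e" "0 < e"
  shows "power_series a f - (\<Sum>k<K. puiseux_term (a k) 0 * f ^ k) \<in> exponents_ge (real K * e)"
proof -
  have m: "f \<in> puiseux_m" using assms puiseux_m_iff_exponents_ge by blast
  have "coeff (power_series a f) x = (\<Sum>k<K. a k * coeff (f ^ k) x)" if "x < real K * e" for x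
    unfolding coeff_power_series[OF m]
  proof (rule suminf_finite)
    fix k
    assume "k \<notin> {..<K}"
    then have "real K * e \<le> real k * e" using assms(2) by simp
    then have "x < real k * e" using that by linarith
    then show "a k * coeff (f ^ k) x = 0"
      using exponents_geD[OF exponents_ge_power[OF assms(1)]] by simp
  qed simp
  then show ?thesis
    by (simp add: exponents_ge_iff coeff_sum coeff_term_times)
qed

section \<open>Principal units\<close>

text \<open>The group 1 + \<mm>.\<close>

definition principal_units :: "puiseux set" where
  "principal_units = {g. g - 1 \<in> puiseux_m}"

lemma puiseux_term_one: "puiseux_term 1 0 = 1"
  by (rule puiseux_eqI) (simp add: puiseux_term.rep_eq coeff_one)

text \<open>The tail estimate at \<open>K = 1\<close>, where the partial sum is the constant
  1.\<close>

lemma power_series_principal_unit: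
  assumes "f \<in> puiseux_m" "a 0 = 1"
  shows "power_series a f \<in> principal_units"
proof -
  obtain e where e: "e > 0" "f \<in> exponents_ge e"
    using assms(1) puiseux_m_iff_exponents_ge by blast
  show ?thesis
    using power_series_tail[OF e(2,1), of a 1] e(1) assms(2)
    by (auto simp: principal_units_def puiseux_m_iff_exponents_ge puiseux_term_one)
qed

lemma principal_units_times:
  assumes "g \<in> principal_units" "h \<in> principal_units"
  shows "g * h \<in> principal_units"
proof -
  have "g * h - 1 = (g - 1) * (h - 1) + ((g - 1) + (h - 1))" by (simp add: algebra_simps)
  also have "\<dots> \<in> puiseux_m"
    using assms by (intro puiseux_m_add puiseux_m_times) (simp_all add: principal_units_def)
  finally show ?thesis by (simp add: principal_units_def)
qed

lemma principal_units_nonzero: "g \<in> principal_units \<Longrightarrow> g \<noteq> 0"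
  by (auto simp: principal_units_def puiseux_m_iff coeff_one)

text \<open>The inverse of \<open>g\<close> is the geometric series in \<open>1 - g\<close>, which
  again has constant term 1.\<close>

lemma principal_units_inverse:
  assumes "g \<in> principal_units"
  shows "inverse g \<in> principal_units"
proof -
  have m: "1 - g \<in> puiseux_m"
    using assms puiseux_m_uminus[of "g - 1"] by (simp add: principal_units_def)
  have "g * power_series (\<lambda>_. 1) (1 - g) = 1" using geometric_series[OF m] by simp
  then have "inverse g = power_series (\<lambda>_. 1) (1 - g)" by (rule inverse_unique)
  then show ?thesis using power_series_principal_unit[OF m] by simp
qed

lemma puiseux_m_times_principal_unit:
  assumes "f \<in> puiseux_m" "g \<in> principal_units"
  shows "f * g \<in> puiseux_m"
proof -
  have "f * g = f * (g - 1) + f" by (simp add: algebra_simps)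
  also have "\<dots> \<in> puiseux_m"
    using assms by (intro puiseux_m_add puiseux_m_times) (simp_all add: principal_units_def)
  finally show ?thesis .
qed

lemma coeff_principal_unit:
  assumes "g \<in> principal_units"
  shows "coeff g 0 = 1" "x < 0 \<Longrightarrow> coeff g x = 0"
  using assms by (auto simp: principal_units_def puiseux_m_iff coeff_one)

section \<open>The Euler derivation\<close>

text \<open>The derivation t d/dt. Unlike d/dt it keeps every exponent in place, so it acts
  coefficientwise and respects the filtration.\<close>

lift_definition euler_deriv :: "puiseux \<Rightarrow> puiseux" is "\<lambda>f x. of_real x * f x"
  by (erule left_finite_subset) auto

lemma coeff_euler_deriv [simp]: "coeff (euler_deriv f) x = of_real x * coeff f x"
  by (simp add: euler_deriv.rep_eq)

lemma euler_deriv_add: "euler_deriv (f + g) = euler_deriv f + euler_deriv g"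
  by (rule puiseux_eqI) (simp add: distrib_left)

lemma euler_deriv_diff: "euler_deriv (f - g) = euler_deriv f - euler_deriv g"
  by (rule puiseux_eqI) (simp add: right_diff_distrib)

lemma euler_deriv_sum: "euler_deriv (sum f A) = (\<Sum>a\<in>A. euler_deriv (f a))"
  by (rule puiseux_eqI) (simp add: coeff_sum sum_distrib_left)

lemma euler_deriv_one: "euler_deriv 1 = 0"
  by (rule puiseux_eqI) (simp add: coeff_one)

lemma euler_deriv_const_times: "euler_deriv (puiseux_term c 0 * f) = puiseux_term c 0 * euler_deriv f"
  by (rule puiseux_eqI) (simp add: coeff_term_times)

text \<open>In each convolution term the factor \<open>x\<close> splits as
  \<open>a + (x - a)\<close>. The derivation only shrinks supports, so one index set serves all
  three products.\<close>

lemma euler_deriv_times: "euler_deriv (f * g) = euler_deriv f * g + f * euler_deriv g"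
proof (rule puiseux_eqI)
  fix x
  let ?A = "{a. coeff f a \<noteq> 0 \<and> coeff g (x - a) \<noteq> 0}"
  have fin: "finite ?A" by (rule finite_convolution)
  have "coeff (euler_deriv (f * g)) x = of_real x * (\<Sum>a\<in>?A. coeff f a * coeff g (x - a))"
    by (subst coeff_times[OF fin, symmetric]) auto
  also have "\<dots> = (\<Sum>a\<in>?A. coeff (euler_deriv f) a * coeff g (x - a)) +
      (\<Sum>a\<in>?A. coeff f a * coeff (euler_deriv g) (x - a))"
    by (simp add: sum_distrib_left sum.distrib[symmetric] algebra_simps)
  also have "\<dots> = coeff (euler_deriv f * g) x + coeff (f * euler_deriv g) x"
    by (subst (1 2) coeff_times[OF fin]) auto
  finally show "coeff (euler_deriv (f * g)) x = coeff (euler_deriv f * g + f * euler_deriv g) x"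
    by simp
qed

lemma euler_deriv_power: "euler_deriv (f ^ Suc k) = of_nat (Suc k) * f ^ k * euler_deriv f"
  by (induction k) (simp_all add: euler_deriv_times algebra_simps)

lemma exponents_ge_euler_deriv: "f \<in> exponents_ge e \<Longrightarrow> euler_deriv f \<in> exponents_ge e"
  by (simp add: exponents_ge_def)

lemma puiseux_m_euler_deriv: "f - 1 \<in> puiseux_m \<Longrightarrow> euler_deriv f \<in> puiseux_m"
  by (auto simp: puiseux_m_iff coeff_one)

text \<open>Only constants have derivative 0, and the only constant in \<mm> is 0.\<close>

lemma euler_deriv_inj:
  assumes "f \<in> puiseux_m" "g \<in> puiseux_m" "euler_deriv f = euler_deriv g"
  shows "f = g"
proof (rule puiseux_eqI)
  fix x
  have "of_real x * coeff f x = of_real x * coeff g x"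
    by (metis assms(3) coeff_euler_deriv)
  then show "coeff f x = coeff g x"
    using assms(1,2) by (cases "x = 0") (simp_all add: puiseux_m_iff)
qed

lemma euler_deriv_surj:
  assumes "g \<in> puiseux_m"
  obtains f where "f \<in> puiseux_m" "euler_deriv f = g"
proof -
  \<comment> \<open>Termwise integration. At \<open>x = 0\<close> the quotient is 0 by convention,
    which is right because \<open>coeff g 0 = 0\<close>.\<close>
  define f where "f = Abs_puiseux (\<lambda>x. coeff g x / of_real x)"
  have "left_finite {x. coeff g x / of_real x \<noteq> 0}"
    by (rule left_finite_subset[of "{x. coeff g x \<noteq> 0}"]) (use coeff[of g] in auto)
  then have f: "coeff f x = coeff g x / of_real x" for x
    unfolding f_def by (simp add: coeff_Abs)
  have "coeff g 0 = 0" using assms by (simp add: puiseux_m_iff)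
  then have "coeff (euler_deriv f) x = coeff g x" for x by (simp add: f)
  then have "euler_deriv f = g" by (rule puiseux_eqI)
  moreover have "f \<in> puiseux_m" using assms by (simp add: puiseux_m_iff f)
  ultimately show thesis using that by blast
qed

text \<open>The assumption \<open>eq\<close> equates logarithmic derivatives with denominators
  cleared. Hence \<open>g / h\<close> has derivative 0, and a principal unit with derivative 0 is
  1.\<close>

lemma principal_unit_eqI:
  assumes g: "g \<in> principal_units" and h: "h \<in> principal_units"
    and eq: "euler_deriv g * h = g * euler_deriv h"
  shows "g = h"
proof -
  define i where "i = inverse h"
  have hi: "h * i = 1" using principal_units_nonzero[OF h] by (simp add: i_def)
  have hi': "euler_deriv h * i + h * euler_deriv i = 0"
    using euler_deriv_times[of h i] by (simp add: hi euler_deriv_one)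
  \<comment> \<open>The extra factor \<open>h\<close> lets \<open>eq\<close> rewrite the first
    summand; then \<open>hi'\<close> makes the whole vanish.\<close>
  have "euler_deriv (g * i) * h = (euler_deriv g * h) * i + g * (h * euler_deriv i)"
    by (simp add: euler_deriv_times algebra_simps)
  also have "\<dots> = g * (euler_deriv h * i + h * euler_deriv i)"
    by (simp only: eq) (simp add: algebra_simps)
  finally have "euler_deriv (g * i) = 0"
    using hi' principal_units_nonzero[OF h] by simp
  then have "euler_deriv (g * i - 1) = euler_deriv 0"
    by (simp add: euler_deriv_diff euler_deriv_one puiseux_eqI)
  moreover have "g * i - 1 \<in> puiseux_m"
    using principal_units_times[OF g principal_units_inverse[OF h]]
    by (simp add: i_def principal_units_def)
  ultimately have "g * i = 1"
    using euler_deriv_inj[of "g * i - 1" 0] by (simp add: puiseux_m_zero)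
  then show ?thesis using hi by (metis mult.commute mult.left_commute mult_1)
qed

section \<open>The exponential\<close>

lemma puiseux_exp_principal_unit: "f \<in> puiseux_m \<Longrightarrow> puiseux_exp f \<in> principal_units"
  unfolding puiseux_exp_def by (rule power_series_principal_unit) simp_all

lemma puiseux_term_mult_of_nat: "puiseux_term c 0 * of_nat k = puiseux_term (c * of_nat k) 0"
  by (induction k) (auto intro!: puiseux_eqI simp: puiseux_term.rep_eq coeff_term_times coeff_one algebra_simps)

text \<open>Differentiation kills the constant term and lowers each degree by one, so the left sum
  has one term more.\<close>

lemma euler_deriv_exp_partial_sum:
  "euler_deriv (\<Sum>k<Suc K. puiseux_term (1 / fact k) 0 * f ^ k) =
     (\<Sum>k<K. puiseux_term (1 / fact k) 0 * f ^ k) * euler_deriv f"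
proof -
  have "puiseux_term (1 / fact (Suc k)) 0 * (of_nat (Suc k) * f ^ k * euler_deriv f) =
      puiseux_term (1 / fact k) 0 * f ^ k * euler_deriv f" for k
  proof -
    have "puiseux_term (1 / fact (Suc k)) 0 * of_nat (Suc k) = puiseux_term (1 / fact k) 0"
      unfolding puiseux_term_mult_of_nat by (simp add: field_simps del: of_nat_Suc)
    then show ?thesis by (metis mult.assoc)
  qed
  then show ?thesis
    by (simp only: sum.lessThan_Suc_shift euler_deriv_add euler_deriv_sum euler_deriv_const_times
        euler_deriv_power sum_distrib_right power_0 euler_deriv_one mult_zero_right add_0_left)
qed

text \<open>The identity is exact for partial sums; subtracting it leaves only tails, which lie
  arbitrarily deep in the filtration.\<close>

lemma euler_deriv_puiseux_exp:
  assumes "f \<in> puiseux_m"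
  shows "euler_deriv (puiseux_exp f) = puiseux_exp f * euler_deriv f"
proof -
  obtain e where e: "e > 0" "f \<in> exponents_ge e"
    using assms puiseux_m_iff_exponents_ge by blast
  define E where "E K = (\<Sum>k<K. puiseux_term (1 / fact k) 0 * f ^ k)" for K
  have tail: "puiseux_exp f - E K \<in> exponents_ge (real K * e)" for K
    unfolding puiseux_exp_def E_def by (rule power_series_tail[OF e(2,1)])
  show ?thesis
  proof (rule exponents_ge_eqI[OF _ e(1)])
    fix K
    have "euler_deriv (puiseux_exp f) - puiseux_exp f * euler_deriv f =
        euler_deriv (puiseux_exp f - E (Suc K)) - (puiseux_exp f - E K) * euler_deriv f"
      using euler_deriv_exp_partial_sum[of f K]
      by (simp add: E_def euler_deriv_diff algebra_simps)
    moreover have "euler_deriv (puiseux_exp f - E (Suc K)) \<in> exponents_ge (real (Suc K) * e)"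
      by (intro exponents_ge_euler_deriv tail)
    \<comment> \<open>This tail starts only at \<open>K * e\<close>; the factor
      \<open>euler_deriv f\<close> contributes the missing \<open>e\<close>.\<close>
    moreover have "(puiseux_exp f - E K) * euler_deriv f \<in> exponents_ge (real (Suc K) * e)"
      using exponents_ge_times[OF tail[of K] exponents_ge_euler_deriv[OF e(2)]]
      by (simp add: algebra_simps)
    ultimately have "euler_deriv (puiseux_exp f) - puiseux_exp f * euler_deriv f
        \<in> exponents_ge (real (Suc K) * e)"
      by (simp add: exponents_ge_diff)
    then show "euler_deriv (puiseux_exp f) - puiseux_exp f * euler_deriv f
        \<in> exponents_ge (real K * e)"
      by (rule exponents_ge_mono) (use e(1) in simp)
  qed
qed

text \<open>Both sides are principal units with logarithmic derivative
  \<open>euler_deriv f + euler_deriv g\<close>.\<close>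

lemma puiseux_exp_add:
  assumes "f \<in> puiseux_m" "g \<in> puiseux_m"
  shows "puiseux_exp (f + g) = puiseux_exp f * puiseux_exp g"
  by (rule principal_unit_eqI)
    (use assms in \<open>simp_all add: puiseux_exp_principal_unit principal_units_times puiseux_m_add
      euler_deriv_puiseux_exp euler_deriv_times euler_deriv_add algebra_simps\<close>)

lemma puiseux_exp_inj:
  assumes "f \<in> puiseux_m" "g \<in> puiseux_m" "puiseux_exp f = puiseux_exp g"
  shows "f = g"
proof (rule euler_deriv_inj[OF assms(1,2)])
  have "puiseux_exp g * euler_deriv f = puiseux_exp g * euler_deriv g"
    by (metis assms euler_deriv_puiseux_exp)
  then show "euler_deriv f = euler_deriv g"
    using principal_units_nonzero[OF puiseux_exp_principal_unit[OF assms(2)]] by simp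
qed

text \<open>The logarithm of \<open>g\<close> is found by integrating its logarithmic derivative,
  which lies in \<mm>.\<close>

lemma puiseux_exp_surj:
  assumes g: "g \<in> principal_units"
  obtains f where "f \<in> puiseux_m" "puiseux_exp f = g"
proof -
  have "euler_deriv g * inverse g \<in> puiseux_m"
    using g puiseux_m_euler_deriv principal_units_inverse puiseux_m_times_principal_unit
    by (auto simp: principal_units_def)
  then obtain f where f: "f \<in> puiseux_m" "euler_deriv f = euler_deriv g * inverse g"
    by (rule euler_deriv_surj)
  have "puiseux_exp f = g"
    by (rule principal_unit_eqI[OF puiseux_exp_principal_unit[OF f(1)] g])
      (use principal_units_nonzero[OF g] in \<open>simp add: euler_deriv_puiseux_exp[OF f(1)] f(2)\<close>)
  then show thesis using that f(1) by blast
qed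

section \<open>Positive series\<close>

lemma leading_exponent_eqI:
  assumes "coeff f d \<noteq> 0" "\<And>x. x < d \<Longrightarrow> coeff f x = 0"
  shows "leading_exponent f = d"
  unfolding leading_exponent_def by (rule Least_equality) (use assms in force)+

text \<open>Replaces \<open>LEAST\<close> by a witness: a nonzero coefficient with none below it is
  the leading one.\<close>

lemma puiseux_pos_iff:
  "f \<in> puiseux_pos \<longleftrightarrow> (\<exists>a>0. \<exists>d. coeff f d = of_real a \<and> (\<forall>x<d. coeff f x = 0))"
proof
  assume f: "f \<in> puiseux_pos"
  then have "f \<noteq> 0" by (simp add: puiseux_pos_def)
  with f show "\<exists>a>0. \<exists>d. coeff f d = of_real a \<and> (\<forall>x<d. coeff f x = 0)"
    using leading_exponent[of f] by (force simp: puiseux_pos_def leading_coeff_def)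
next
  assume "\<exists>a>0. \<exists>d. coeff f d = of_real a \<and> (\<forall>x<d. coeff f x = 0)"
  then obtain a d where ad: "a > 0" "coeff f d = of_real a" "\<And>x. x < d \<Longrightarrow> coeff f x = 0"
    by blast
  then have "leading_exponent f = d" by (intro leading_exponent_eqI) auto
  then show "f \<in> puiseux_pos" using ad by (auto simp: puiseux_pos_def leading_coeff_def)
qed

text \<open>Recovers the leading term from such a product, for the uniqueness of polar
  forms.\<close>

lemma leading_term_times_unit:
  assumes "g \<in> principal_units" "c \<noteq> 0"
  shows "leading_exponent (puiseux_term c d * g) = d" "leading_coeff (puiseux_term c d * g) = c"
proof -
  show "leading_exponent (puiseux_term c d * g) = d"
    by (rule leading_exponent_eqI) (use assms coeff_principal_unit in \<open>auto simp: coeff_term_times\<close>)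
  then show "leading_coeff (puiseux_term c d * g) = c"
    using coeff_principal_unit(1)[OF assms(1)] by (simp add: leading_coeff_def coeff_term_times)
qed

lemma puiseux_term_times_term: "puiseux_term b d * puiseux_term c e = puiseux_term (b * c) (d + e)"
  by (rule puiseux_eqI) (auto simp: coeff_term_times puiseux_term.rep_eq)

lemma puiseux_term_cancel:
  assumes "c \<noteq> 0" "puiseux_term c d * g = puiseux_term c d * h"
  shows "g = h"
proof -
  have "puiseux_term (1 / c) (- d) * puiseux_term c d = 1"
    using assms(1) by (simp add: puiseux_term_times_term puiseux_term_one)
  then show ?thesis by (metis assms(2) mult.assoc mult_1)
qed

text \<open>Dividing by the leading term leaves constant term 1 and no negative exponents.\<close>

lemma puiseux_pos_decompose:
  assumes "f \<in> puiseux_pos"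
  obtains a d g where "a > 0" "g \<in> principal_units" "f = puiseux_term (of_real a) d * g"
proof -
  obtain a d where ad: "a > 0" "coeff f d = of_real a" "\<And>x. x < d \<Longrightarrow> coeff f x = 0"
    using assms puiseux_pos_iff by blast
  define g where "g = puiseux_term (1 / of_real a) (- d) * f"
  have "0 < x" if x: "coeff (g - 1) x \<noteq> 0" for x
  proof (rule ccontr)
    assume "\<not> 0 < x"
    \<comment> \<open>Stated with \<open>x + d\<close> because \<open>coeff g x\<close> is
      \<open>coeff f (x + d)\<close> divided by \<open>a\<close>.\<close>
    then consider "x = 0" | "x + d < d" by linarith
    then show False
      using x ad by cases (auto simp: g_def coeff_term_times coeff_one)
  qed
  then have "g \<in> principal_units" by (simp add: principal_units_def puiseux_m_def)
  moreover have "f = puiseux_term (of_real a) d * g"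
    using ad(1)
    by (simp add: g_def mult.assoc[symmetric] puiseux_term_times_term puiseux_term_one)
  ultimately show thesis using that ad(1) by blast
qed

lemma puiseux_term_times_unit_pos:
  assumes "g \<in> principal_units" "a > 0"
  shows "puiseux_term (of_real a) d * g \<in> puiseux_pos"
  unfolding puiseux_pos_iff
  by (rule exI[of _ a], intro conjI exI[of _ d])
    (use assms coeff_principal_unit in \<open>auto simp: coeff_term_times\<close>)

section \<open>Closure properties of positive series\<close>

lemma puiseux_pos_times:
  assumes "f \<in> puiseux_pos" "g \<in> puiseux_pos"
  shows "f * g \<in> puiseux_pos"
proof -
  obtain a d h where f: "a > 0" "h \<in> principal_units" "f = puiseux_term (of_real a) d * h"
    using puiseux_pos_decompose[OF assms(1)] .
  obtain b e k where g: "b > 0" "k \<in> principal_units" "g = puiseux_term (of_real b) e * k"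
    using puiseux_pos_decompose[OF assms(2)] .
  have "f * g = (puiseux_term (of_real a) d * puiseux_term (of_real b) e) * (h * k)"
    by (simp add: f(3) g(3) ac_simps)
  then have "f * g = puiseux_term (of_real (a * b)) (d + e) * (h * k)"
    by (simp add: puiseux_term_times_term)
  then show ?thesis
    using puiseux_term_times_unit_pos[OF principal_units_times[OF f(2) g(2)], of "a * b"] f(1) g(1)
    by simp
qed

text \<open>The smaller leading exponent wins; at equal exponents the positive leading coefficients
  add up.\<close>

lemma puiseux_pos_add:
  assumes "f \<in> puiseux_pos" "g \<in> puiseux_pos"
  shows "f + g \<in> puiseux_pos"
proof -
  obtain a d where f: "a > 0" "coeff f d = of_real a" "\<forall>x<d. coeff f x = 0"
    using assms(1) puiseux_pos_iff by blast
  obtain b e where g: "b > 0" "coeff g e = of_real b" "\<forall>x<e. coeff g x = 0"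
    using assms(2) puiseux_pos_iff by blast
  consider "d < e" | "e < d" | "d = e" by linarith
  then show ?thesis
  proof cases
    case 1
    then show ?thesis
      unfolding puiseux_pos_iff by (intro exI[of _ a] conjI exI[of _ d]) (use f g in auto)
  next
    case 2
    then show ?thesis
      unfolding puiseux_pos_iff by (intro exI[of _ b] conjI exI[of _ e]) (use f g in auto)
  next
    case 3
    then show ?thesis
      unfolding puiseux_pos_iff by (intro exI[of _ "a + b"] conjI exI[of _ d]) (use f g in auto)
  qed
qed

lemma puiseux_pos_scaleR:
  assumes "f \<in> puiseux_pos" "r > 0"
  shows "r *\<^sub>R f \<in> puiseux_pos"
proof -
  obtain a d where f: "a > 0" "coeff f d = of_real a" "\<forall>x<d. coeff f x = 0"
    using assms(1) puiseux_pos_iff by blast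
  show ?thesis
    unfolding puiseux_pos_iff
    by (rule exI[of _ "r * a"], intro conjI exI[of _ d])
      (use f assms(2) in \<open>auto simp: scaleR_puiseux.rep_eq scaleR_conv_of_real[where 'a = complex]\<close>)
qed

lemma puiseux_pos_sum:
  assumes "finite A" "A \<noteq> {}" "\<And>a. a \<in> A \<Longrightarrow> f a \<in> puiseux_pos"
  shows "sum f A \<in> puiseux_pos"
  using assms by (induction rule: finite_ne_induct) (auto intro: puiseux_pos_add)

text \<open>Terms with coefficient 0 are dropped first, since 0 is not positive; at least one term
  remains.\<close>

lemma puiseux_pos_nonneg_combination:
  assumes "finite A" "\<And>a. a \<in> A \<Longrightarrow> f a \<in> puiseux_pos" "\<And>a. a \<in> A \<Longrightarrow> 0 \<le> c a"
    and "\<exists>a\<in>A. c a \<noteq> 0"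
  shows "(\<Sum>a\<in>A. c a *\<^sub>R f a) \<in> puiseux_pos"
proof -
  have "(\<Sum>a\<in>A. c a *\<^sub>R f a) = (\<Sum>a\<in>{a\<in>A. c a \<noteq> 0}. c a *\<^sub>R f a)"
    by (rule sum.mono_neutral_right) (use assms(1) in auto)
  also have "\<dots> \<in> puiseux_pos"
    by (rule puiseux_pos_sum) (use assms in \<open>auto intro!: puiseux_pos_scaleR simp: order.strict_iff_order\<close>)
  finally show ?thesis .
qed

section \<open>The polar form\<close>

lemma of_real_puiseux: "of_real r = puiseux_term (of_real r) 0"
  by (rule puiseux_eqI) (simp add: of_real_def scaleR_puiseux.rep_eq puiseux_term.rep_eq coeff_one)

text \<open>Exhibits a polar value as a positive leading term times a principal unit.\<close>

lemma polar_value_eq: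
  "polar_value u d w v =
     puiseux_term (of_real (exp (v \<bullet> u))) (v \<bullet> d) * puiseux_exp (pairing_m v w)"
  unfolding polar_value_def of_real_puiseux puiseux_term_times_term by simp

lemma pairing_m_in_m: "(\<And>j. w $ j \<in> puiseux_m) \<Longrightarrow> pairing_m v w \<in> puiseux_m"
  unfolding pairing_m_def by (intro puiseux_m_sum puiseux_m_scaleR)

lemma polar_value_pos: "(\<And>j. w $ j \<in> puiseux_m) \<Longrightarrow> polar_value u d w v \<in> puiseux_pos"
  unfolding polar_value_eq
  by (intro puiseux_term_times_unit_pos puiseux_exp_principal_unit pairing_m_in_m) auto

lemma polar_value_add:
  assumes "\<And>j. w $ j \<in> puiseux_m"
  shows "polar_value u d w (v + v') = polar_value u d w v * polar_value u d w v'"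
proof -
  have "pairing_m (v + v') w = pairing_m v w + pairing_m v' w"
    by (simp add: pairing_m_def scaleR_add_left sum.distrib)
  then have "puiseux_exp (pairing_m (v + v') w) =
      puiseux_exp (pairing_m v w) * puiseux_exp (pairing_m v' w)"
    using puiseux_exp_add[OF pairing_m_in_m pairing_m_in_m] assms by metis
  moreover have "puiseux_term (of_real (exp ((v + v') \<bullet> u))) ((v + v') \<bullet> d) =
      puiseux_term (of_real (exp (v \<bullet> u))) (v \<bullet> d) * puiseux_term (of_real (exp (v' \<bullet> u))) (v' \<bullet> d)"
    by (simp add: puiseux_term_times_term inner_add_left exp_add)
  ultimately show ?thesis by (simp add: polar_value_eq ac_simps)
qed

lemma real_char_axis: "real_char (axis j 1) = axis j 1"
  by (simp add: real_char_def axis_def vec_eq_iff)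

lemma real_char_add: "real_char (v + w) = real_char v + real_char w"
  by (simp add: real_char_def vec_eq_iff)

lemma polar_value_axis:
  "polar_value u d w (axis j 1) = puiseux_term (of_real (exp (u $ j))) (d $ j) * puiseux_exp (w $ j)"
proof -
  have "pairing_m (axis j 1) w = (\<Sum>i\<in>UNIV. if i = j then w $ i else 0)"
    unfolding pairing_m_def by (rule sum.cong) (auto simp: axis_def)
  then show ?thesis by (simp add: polar_value_eq inner_axis')
qed

text \<open>The axis vectors generate the lattice. Applied to a quotient of two homomorphisms, this
  shows that agreement on the axes is enough.\<close>

lemma hom_eq_one_if_axes:
  fixes f :: "int ^ 'r \<Rightarrow> 'a :: field"
  assumes add: "\<And>v w. f (v + w) = f v * f w"
    and axes: "\<And>j. f (axis j 1) = 1"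
  shows "f v = 1"
proof -
  have zero: "f 0 = 1"
    \<comment> \<open>Any index would do: the value at 0 times 1 equals 1.\<close>
    using add[of 0 "axis undefined 1"] axes by simp
  have axis_mult: "f (axis j k) = 1" for j k
  proof (induction k rule: int_induct[where k = 0])
    case base
    have "axis j 0 = (0 :: int ^ 'r)" by (simp add: vec_eq_iff axis_def)
    then show ?case by (simp only: zero)
  next
    case (step1 i)
    have "axis j (i + 1) = axis j i + (axis j 1 :: int ^ 'r)" by (simp add: vec_eq_iff axis_def)
    then show ?case using step1 by (simp add: add axes)
  next
    case (step2 i)
    have "axis j i = axis j (i - 1) + (axis j 1 :: int ^ 'r)" by (simp add: vec_eq_iff axis_def)
    then have "f (axis j i) = f (axis j (i - 1))" by (simp add: add axes)
    then show ?case using step2 by simp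
  qed
  have "f (\<Sum>j\<in>A. axis j (v $ j)) = 1" for A
    by (induction A rule: infinite_finite_induct) (simp_all add: zero add axis_mult)
  moreover have "v = (\<Sum>j\<in>UNIV. axis j (v $ j))"
    by (simp add: vec_eq_iff axis_def)
  ultimately show ?thesis by metis
qed

text \<open>Decomposing the values of \<open>p\<close> at the axis vectors gives the coordinates of
  \<open>u\<close>, \<open>d\<close> and \<open>w\<close>.\<close>

lemma polar_form_exists:
  assumes "p \<in> torus_pos"
  shows "\<exists>c. is_polar_form p c"
proof -
  have "\<exists>a d w. w \<in> puiseux_m \<and>
      p (axis j 1) = puiseux_term (of_real (exp a)) d * puiseux_exp w" for j
  proof -
    have "p (axis j 1) \<in> puiseux_pos" using assms by (simp add: torus_pos_def)
    then obtain a d g where "a > 0" "g \<in> principal_units"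
        "p (axis j 1) = puiseux_term (of_real a) d * g"
      by (rule puiseux_pos_decompose)
    \<comment> \<open>The leading coefficient is \<open>exp (ln a)\<close>, and the principal unit
      is an exponential by surjectivity.\<close>
    then show ?thesis by (metis exp_ln puiseux_exp_surj)
  qed
  then obtain A D W where W: "\<And>j. W j \<in> puiseux_m"
    and p: "\<And>j. p (axis j 1) = puiseux_term (of_real (exp (A j))) (D j) * puiseux_exp (W j)"
    by metis
  define u d w where "u = (\<chi> j. A j)" and "d = (\<chi> j. D j)" and "w = (\<chi> j. W j)"
  have w: "w $ j \<in> puiseux_m" for j by (simp add: w_def W)
  define q where "q v = polar_value u d w (real_char v)" for v
  have q_add: "q (v + v') = q v * q v'" for v v'
    unfolding q_def real_char_add by (rule polar_value_add[OF w])
  have p_add: "p (v + v') = p v * p v'" for v v'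
    using assms by (simp add: torus_pos_def)
  have q_nz: "q v \<noteq> 0" for v
    using polar_value_pos[of w u d "real_char v"] w by (simp add: q_def puiseux_pos_def)
  have q_axis: "q (axis j 1) = p (axis j 1)" for j
    by (simp add: q_def real_char_axis polar_value_axis p u_def d_def w_def)
  have "p v / q v = 1" for v
    by (rule hom_eq_one_if_axes[of "\<lambda>v. p v / q v"])
      (use q_nz in \<open>simp_all add: p_add q_add q_axis[symmetric]\<close>)
  then have "p v = q v" for v using q_nz by (simp add: divide_eq_1_iff)
  then have "is_polar_form p (u, d, w)" using w by (simp add: is_polar_form_def q_def)
  then show ?thesis by blast
qed

text \<open>The value at the axis vector \<open>j\<close> fixes all coordinates at \<open>j\<close>:
  the leading exponent is \<open>d $ j\<close>, the leading coefficient is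
  \<open>exp (u $ j)\<close>, and the remaining unit determines \<open>w $ j\<close> as
  \<open>puiseux_exp\<close> is injective on \<mm>.\<close>

lemma polar_form_unique:
  assumes "is_polar_form p c" "is_polar_form p c'"
  shows "c = c'"
proof -
  obtain u d w where c: "c = (u, d, w)" by (rule prod_cases3)
  obtain u' d' w' where c': "c' = (u', d', w')" by (rule prod_cases3)
  have w: "w $ j \<in> puiseux_m" "w' $ j \<in> puiseux_m" for j
    using assms by (auto simp: is_polar_form_def c c')
  have "u $ j = u' $ j \<and> d $ j = d' $ j \<and> w $ j = w' $ j" for j
  proof -
    let ?f = "puiseux_term (of_real (exp (u $ j))) (d $ j) * puiseux_exp (w $ j)"
    let ?g = "puiseux_term (of_real (exp (u' $ j))) (d' $ j) * puiseux_exp (w' $ j)"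
    have eq: "?f = ?g"
      using assms by (simp add: is_polar_form_def c c' flip: polar_value_axis real_char_axis)
    note unit = puiseux_exp_principal_unit[OF w(1)] puiseux_exp_principal_unit[OF w(2)]
    have d: "d $ j = d' $ j"
      using leading_term_times_unit(1)[OF unit(1)] leading_term_times_unit(1)[OF unit(2)] eq
      by (metis exp_not_eq_zero of_real_eq_0_iff)
    have "complex_of_real (exp (u $ j)) = of_real (exp (u' $ j))"
      using leading_term_times_unit(2)[OF unit(1)] leading_term_times_unit(2)[OF unit(2)] eq
      by (metis exp_not_eq_zero of_real_eq_0_iff)
    then have u: "u $ j = u' $ j" by (metis exp_inj_iff of_real_eq_iff)
    have "puiseux_exp (w $ j) = puiseux_exp (w' $ j)"
      by (rule puiseux_term_cancel[of "of_real (exp (u $ j))" "d $ j"])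
        (use eq u d in auto)
    then show ?thesis using u d puiseux_exp_inj w by blast
  qed
  then show ?thesis by (simp add: c c' vec_eq_iff)
qed

text \<open>Existence and uniqueness make the \<open>THE\<close> in \<open>real_power\<close> denote
  an actual polar form, whose values are positive.\<close>

lemma real_power_pos:
  assumes "p \<in> torus_pos"
  shows "real_power p v \<in> puiseux_pos"
proof -
  obtain c where c: "is_polar_form p c" using polar_form_exists[OF assms] by blast
  then have "(THE c. is_polar_form p c) = c"
    using polar_form_unique by blast
  with c show ?thesis
    by (auto simp: real_power_def is_polar_form_def split: prod.splits intro!: polar_value_pos)
qed

section \<open>The Hessian\<close>

text \<open>Exponents may repeat, but the factor depends on the exponent alone, so scaling commutes
  with collecting like terms.\<close>

lemma log_deriv_poly_of_terms:
  "log_deriv u (poly_of_terms n \<gamma> v) = poly_of_terms n (\<lambda>i. of_real (v i \<bullet> u) * \<gamma> i) v"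
  by (rule poly_mapping_eqI)
    (auto simp: lookup_log_deriv poly_of_terms_def lookup_sum lookup_single when_def
      sum_distrib_left intro!: sum.cong)

lemma hessian_poly_of_terms:
  "hessian (poly_of_terms n \<gamma> v) p u1 u2 =
     (\<Sum>i<n. ((v i \<bullet> u1) * (v i \<bullet> u2)) *\<^sub>R (\<gamma> i * real_power p (v i)))"
  by (simp add: hessian_def log_deriv_poly_of_terms poly_eval_poly_of_terms scaleR_conv_of_real
      mult.assoc)

lemma bilinear_hessian: "bilinear (hessian (poly_of_terms n \<gamma> v) p)"
  unfolding bilinear_def hessian_poly_of_terms
  by (auto intro!: linearI simp: scaleR_sum_right algebra_simps sum.distrib)

text \<open>Spanning provides, for each nonzero \<open>u\<close>, an exponent not orthogonal to
  \<open>u\<close>. By \<open>hessian_pos_imp_span\<close> the positivity claim in turn forces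
  spanning.\<close>

theorem lemma5p4:
  fixes n :: nat and \<gamma> :: "nat \<Rightarrow> puiseux" and v :: "nat \<Rightarrow> real ^ 'r"
    and p :: "int ^ 'r \<Rightarrow> puiseux"
  assumes "\<And>i. i < n \<Longrightarrow> \<gamma> i \<in> puiseux_pos"
    and "span (v ` {..<n}) = UNIV"
    and "p \<in> torus_pos"
  shows "bilinear (hessian (poly_of_terms n \<gamma> v) p) \<and>
    (\<forall>u. u \<noteq> 0 \<longrightarrow> hessian (poly_of_terms n \<gamma> v) p u u \<in> puiseux_pos)"
proof (intro conjI allI impI bilinear_hessian)
  fix u :: "real ^ 'r"
  assume u: "u \<noteq> 0"
  have "\<exists>i\<in>{..<n}. v i \<bullet> u \<noteq> 0"
  proof (rule ccontr)
    assume "\<not> ?thesis"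
    then have "orthogonal u x" if "x \<in> v ` {..<n}" for x
      using that by (auto simp: orthogonal_def inner_commute)
    \<comment> \<open>Orthogonality passes from the exponents to their span, which contains
      \<open>u\<close> itself.\<close>
    then have "orthogonal u u"
      using assms(2) by (intro orthogonal_to_span[of u "v ` {..<n}"]) auto
    then show False using u by (simp add: orthogonal_self)
  qed
  then show "hessian (poly_of_terms n \<gamma> v) p u u \<in> puiseux_pos"
    unfolding hessian_poly_of_terms
    by (intro puiseux_pos_nonneg_combination puiseux_pos_times assms(1) real_power_pos assms(3)) auto
qed

end
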